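(* Let $K$ be any field and let $\alpha\in K$, $\alpha\neq 0$. Let $L_5$, $L_6$, $L_7$ be the three-dimensional Leibniz algebras over $K$ with basis $\{e_1,e_2,e_3\}$ and nonzero products of basis elements \[ L_5:\ e_2e_2=e_1,\ e_3e_3=\alpha e_1;\qquad L_6:\ e_2e_2=e_1,\ e_3e_3=\alpha e_1,\ e_2e_3=e_1;\qquad L_7:\ e_2e_3=e_1 . \] Then the polynomial identities of $L_6$ and $L_7$ coincide and are generated by the polynomial $x_1x_2x_3$, that is, $T(L_6)=T(L_7)=\langle x_1x_2x_3\rangle_T$, while \[ T(L_5)=\langle x_1x_2-x_2x_1,\ x_1x_2x_3\rangle_T . \]
   Context: A (right) Leibniz algebra over $K$ is a $K$-algebra satisfying $x(yz)=(xy)z-(xz)y$. $\mathcal L\langle X\rangle$ denotes the free Leibniz algebra over $K$ on $X=\{x_1,x_2,\dots\}$. Products without brackets are left-normed: $a_1a_2\cdots a_m=(\cdots((a_1a_2)a_3)\cdots)a_m$. For a Leibniz algebra $L$, $T(L)\subseteq\mathcal L\langle X\rangle$ is the set of polynomial identities of $L$, i.e. of polynomials vanishing under all substitutions of elements of $L$ for the variables. A $T$-ideal is an ideal of $\mathcal L\langle X\rangle$ invariant under all endomorphisms, and $\langle S\rangle_T$ is the smallest $T$-ideal containing $S$. Products of basis elements not listed are zero. *)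

theory Defs
  imports "HOL-Analysis.Cartesian_Space" "HOL-Library.Numeral_Type"
begin

section \<open>Algebras\<close>

locale nonassoc_algebra = vector_space scale
  for scale :: "'k::field \<Rightarrow> 'v::ab_group_add \<Rightarrow> 'v" +
  fixes mul :: "'v \<Rightarrow> 'v \<Rightarrow> 'v"
  assumes mul_add_left: "mul (x + y) z = mul x z + mul y z"
    and mul_add_right: "mul x (y + z) = mul x y + mul x z"
    and mul_scale_left: "mul (scale c x) y = scale c (mul x y)"
    and mul_scale_right: "mul x (scale c y) = scale c (mul x y)"

locale leibniz_algebra = nonassoc_algebra scale mul
  for scale :: "'k::field \<Rightarrow> 'v::ab_group_add \<Rightarrow> 'v" and mul :: "'v \<Rightarrow> 'v \<Rightarrow> 'v" +
  assumes leibniz: "mul x (mul y z) = mul (mul x y) z - mul (mul x z) y"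

definition alg_hom ::
  "('k::field \<Rightarrow> 'v::ab_group_add \<Rightarrow> 'v) \<Rightarrow> ('v \<Rightarrow> 'v \<Rightarrow> 'v) \<Rightarrow>
   ('k \<Rightarrow> 'w::ab_group_add \<Rightarrow> 'w) \<Rightarrow> ('w \<Rightarrow> 'w \<Rightarrow> 'w) \<Rightarrow> ('v \<Rightarrow> 'w) \<Rightarrow> bool"
  where "alg_hom s1 m1 s2 m2 f \<longleftrightarrow>
    Vector_Spaces.linear s1 s2 f \<and> (\<forall>x y. f (m1 x y) = m2 (f x) (f y))"

definition alg_ideal ::
  "('k::field \<Rightarrow> 'v::ab_group_add \<Rightarrow> 'v) \<Rightarrow> ('v \<Rightarrow> 'v \<Rightarrow> 'v) \<Rightarrow> 'v set \<Rightarrow> bool"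
  where "alg_ideal s m I \<longleftrightarrow>
    module.subspace s I \<and> (\<forall>x. \<forall>y\<in>I. m x y \<in> I \<and> m y x \<in> I)"


section \<open>The free Leibniz algebra\<close>

text \<open>
  The free Leibniz algebra on countably many generators is the algebra of formal
  terms modulo the least congruence that contains the axioms of a Leibniz algebra.
  Its universal property is lemma \<open>free_leibniz_universal\<close>.
\<close>

datatype 'k lterm =
    Var nat
  | Zero
  | Add "'k lterm" "'k lterm"
  | Neg "'k lterm"
  | Scale 'k "'k lterm"
  | Mul "'k lterm" "'k lterm"

inductive lcong :: "'k::field lterm \<Rightarrow> 'k lterm \<Rightarrow> bool" where
  refl: "lcong s s"
| sym: "lcong s t \<Longrightarrow> lcong t s"
| trans: "lcong s t \<Longrightarrow> lcong t u \<Longrightarrow> lcong s u"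
| Add: "lcong s s' \<Longrightarrow> lcong t t' \<Longrightarrow> lcong (Add s t) (Add s' t')"
| Neg: "lcong s s' \<Longrightarrow> lcong (Neg s) (Neg s')"
| Scale: "lcong s s' \<Longrightarrow> lcong (Scale c s) (Scale c s')"
| Mul: "lcong s s' \<Longrightarrow> lcong t t' \<Longrightarrow> lcong (Mul s t) (Mul s' t')"
| add_assoc: "lcong (Add (Add s t) u) (Add s (Add t u))"
| add_comm: "lcong (Add s t) (Add t s)"
| add_zero: "lcong (Add Zero s) s"
| add_neg: "lcong (Add (Neg s) s) Zero"
| scale_add_right: "lcong (Scale c (Add s t)) (Add (Scale c s) (Scale c t))"
| scale_add_left: "lcong (Scale (c + d) s) (Add (Scale c s) (Scale d s))"
| scale_scale: "lcong (Scale c (Scale d s)) (Scale (c * d) s)"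
| scale_one: "lcong (Scale 1 s) s"
| mul_add_left: "lcong (Mul (Add s t) u) (Add (Mul s u) (Mul t u))"
| mul_add_right: "lcong (Mul s (Add t u)) (Add (Mul s t) (Mul s u))"
| mul_scale_left: "lcong (Mul (Scale c s) t) (Scale c (Mul s t))"
| mul_scale_right: "lcong (Mul s (Scale c t)) (Scale c (Mul s t))"
| leibniz: "lcong (Mul s (Mul t u)) (Add (Mul (Mul s t) u) (Neg (Mul (Mul s u) t)))"

quotient_type (overloaded) 'k free_leibniz = "'k::field lterm" / lcong
  by (intro equivpI reflpI sympI transpI) (blast intro: lcong.refl lcong.sym lcong.trans)+

instantiation free_leibniz :: (field) "{ab_group_add, times}"
begin

lift_definition zero_free_leibniz :: "'a free_leibniz" is Zero .
lift_definition plus_free_leibniz :: "'a free_leibniz \<Rightarrow> 'a free_leibniz \<Rightarrow> 'a free_leibniz"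
  is Add by (rule lcong.Add)
lift_definition uminus_free_leibniz :: "'a free_leibniz \<Rightarrow> 'a free_leibniz"
  is Neg by (rule lcong.Neg)
lift_definition times_free_leibniz :: "'a free_leibniz \<Rightarrow> 'a free_leibniz \<Rightarrow> 'a free_leibniz"
  is Mul by (rule lcong.Mul)
definition minus_free_leibniz :: "'a free_leibniz \<Rightarrow> 'a free_leibniz \<Rightarrow> 'a free_leibniz"
  where "minus_free_leibniz f g = f + - g"

instance
proof
  fix f g h :: "'a free_leibniz"
  show "f + g + h = f + (g + h)" by transfer (rule lcong.add_assoc)
  show "f + g = g + f" by transfer (rule lcong.add_comm)
  show "0 + f = f" by transfer (rule lcong.add_zero)
  show "- f + f = 0" by transfer (rule lcong.add_neg)
  show "f - g = f + - g" by (rule minus_free_leibniz_def)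
qed

end

lift_definition fl_scale :: "'k::field \<Rightarrow> 'k free_leibniz \<Rightarrow> 'k free_leibniz"
  is Scale by (rule lcong.Scale)

text \<open>Generators are numbered from 0: \<open>gen n\<close> is the variable $x_{n+1}$.\<close>

lift_definition gen :: "nat \<Rightarrow> 'k::field free_leibniz" is Var .

lemma leibniz_algebra_free: "leibniz_algebra (fl_scale :: 'k::field \<Rightarrow> _) (*)"
proof
  fix c d :: 'k and f g h :: "'k free_leibniz"
  show "fl_scale c (f + g) = fl_scale c f + fl_scale c g"
    by transfer (rule lcong.scale_add_right)
  show "fl_scale (c + d) f = fl_scale c f + fl_scale d f"
    by transfer (rule lcong.scale_add_left)
  show "fl_scale c (fl_scale d f) = fl_scale (c * d) f"
    by transfer (rule lcong.scale_scale)
  show "fl_scale 1 f = f" by transfer (rule lcong.scale_one)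
  show "(f + g) * h = f * h + g * h" by transfer (rule lcong.mul_add_left)
  show "f * (g + h) = f * g + f * h" by transfer (rule lcong.mul_add_right)
  show "fl_scale c f * g = fl_scale c (f * g)" by transfer (rule lcong.mul_scale_left)
  show "f * fl_scale c g = fl_scale c (f * g)" by transfer (rule lcong.mul_scale_right)
  show "f * (g * h) = f * g * h - f * h * g"
    unfolding minus_free_leibniz_def by transfer (rule lcong.leibniz)
qed

primrec eval_lterm ::
  "('k \<Rightarrow> 'v::ab_group_add \<Rightarrow> 'v) \<Rightarrow> ('v \<Rightarrow> 'v \<Rightarrow> 'v) \<Rightarrow> (nat \<Rightarrow> 'v) \<Rightarrow> 'k lterm \<Rightarrow> 'v"
where
  "eval_lterm s m a (Var n) = a n"
| "eval_lterm s m a Zero = 0"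
| "eval_lterm s m a (Add t u) = eval_lterm s m a t + eval_lterm s m a u"
| "eval_lterm s m a (Neg t) = - eval_lterm s m a t"
| "eval_lterm s m a (Scale c t) = s c (eval_lterm s m a t)"
| "eval_lterm s m a (Mul t u) = m (eval_lterm s m a t) (eval_lterm s m a u)"

lemma eval_lterm_cong:
  assumes "leibniz_algebra s m" and "lcong t u"
  shows "eval_lterm s m a t = eval_lterm s m a u"
proof -
  interpret leibniz_algebra s m by fact
  show ?thesis
    using assms(2)
    by induction
      (simp_all add: mul_add_left mul_add_right mul_scale_left mul_scale_right
        leibniz scale_right_distrib scale_left_distrib add_ac)
qed

lemma abs_free_leibniz_simps:
  "abs_free_leibniz (Var n) = gen n"
  "abs_free_leibniz Zero = 0"
  "abs_free_leibniz (Add t u) = abs_free_leibniz t + abs_free_leibniz u"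
  "abs_free_leibniz (Neg t) = - abs_free_leibniz t"
  "abs_free_leibniz (Scale c t) = fl_scale c (abs_free_leibniz t)"
  "abs_free_leibniz (Mul t u) = abs_free_leibniz t * abs_free_leibniz u"
  by (simp_all add: gen.abs_eq zero_free_leibniz.abs_eq plus_free_leibniz.abs_eq
      uminus_free_leibniz.abs_eq fl_scale.abs_eq times_free_leibniz.abs_eq)

theorem free_leibniz_universal:
  fixes s :: "'k::field \<Rightarrow> 'v::ab_group_add \<Rightarrow> 'v"
  assumes L: "leibniz_algebra s m"
  shows "\<exists>!\<phi>. alg_hom fl_scale (*) s m \<phi> \<and> (\<forall>n. \<phi> (gen n) = a n)"
proof (rule ex_ex1I)
  interpret L: leibniz_algebra s m by (rule L)
  interpret F: leibniz_algebra "fl_scale :: 'k \<Rightarrow> _" "(*)" by (rule leibniz_algebra_free)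
  define \<phi> where "\<phi> f = eval_lterm s m a (rep_free_leibniz f)" for f
  have abs: "\<phi> (abs_free_leibniz t) = eval_lterm s m a t" for t
    unfolding \<phi>_def
    by (rule eval_lterm_cong[OF L])
      (metis Quotient_free_leibniz Quotient_rep_abs lcong.refl)
  have add: "\<phi> (f + g) = \<phi> f + \<phi> g" and mul: "\<phi> (f * g) = m (\<phi> f) (\<phi> g)"
    and sc: "\<phi> (fl_scale c f) = s c (\<phi> f)" for f g c
    by (induct f, induct g, simp add: abs flip: abs_free_leibniz_simps)+
  have gen: "\<phi> (gen n) = a n" for n
    by (simp add: abs flip: abs_free_leibniz_simps)
  have "Vector_Spaces.linear fl_scale s \<phi>"
    by unfold_locales (simp_all add: add sc)
  with mul gen show "\<exists>\<phi>. alg_hom fl_scale (*) s m \<phi> \<and> (\<forall>n. \<phi> (gen n) = a n)"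
    unfolding alg_hom_def by blast
next
  fix \<phi> \<psi>
  assume \<phi>: "alg_hom fl_scale (*) s m \<phi> \<and> (\<forall>n. \<phi> (gen n) = a n)"
    and \<psi>: "alg_hom fl_scale (*) s m \<psi> \<and> (\<forall>n. \<psi> (gen n) = a n)"
  have *: "\<theta> (abs_free_leibniz t) = eval_lterm s m a t"
    if \<theta>: "alg_hom fl_scale (*) s m \<theta> \<and> (\<forall>n. \<theta> (gen n) = a n)" for \<theta> t
  proof -
    interpret Vector_Spaces.linear fl_scale s \<theta> using \<theta> by (simp add: alg_hom_def)
    show ?thesis
      using \<theta> by (induct t) (simp_all add: abs_free_leibniz_simps add scale neg zero alg_hom_def)
  qed
  show "\<phi> = \<psi>"
  proof
    fix f show "\<phi> f = \<psi> f" by (induct f) (simp add: *[OF \<phi>] *[OF \<psi>])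
  qed
qed


section \<open>Polynomial identities and T-ideals\<close>

text \<open>
  Substitution of \<open>a n\<close> for \<open>gen n\<close>; uniquely determined, by
  \<open>free_leibniz_universal\<close>, whenever the target is a Leibniz algebra.
\<close>

definition subst ::
  "('k::field \<Rightarrow> 'v::ab_group_add \<Rightarrow> 'v) \<Rightarrow> ('v \<Rightarrow> 'v \<Rightarrow> 'v) \<Rightarrow> (nat \<Rightarrow> 'v) \<Rightarrow> 'k free_leibniz \<Rightarrow> 'v"
  where "subst s m a = (THE \<phi>. alg_hom fl_scale (*) s m \<phi> \<and> (\<forall>n. \<phi> (gen n) = a n))"

definition identities ::
  "('k::field \<Rightarrow> 'v::ab_group_add \<Rightarrow> 'v) \<Rightarrow> ('v \<Rightarrow> 'v \<Rightarrow> 'v) \<Rightarrow> 'k free_leibniz set"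
  where "identities s m = {f. \<forall>a. subst s m a f = 0}"

definition t_ideal :: "'k::field free_leibniz set \<Rightarrow> bool"
  where "t_ideal I \<longleftrightarrow> alg_ideal fl_scale (*) I \<and>
    (\<forall>\<phi>. alg_hom fl_scale (*) fl_scale (*) \<phi> \<longrightarrow> \<phi> ` I \<subseteq> I)"

definition t_ideal_gen :: "'k::field free_leibniz set \<Rightarrow> 'k free_leibniz set"
  where "t_ideal_gen S = \<Inter>{I. t_ideal I \<and> S \<subseteq> I}"

lemma subst_hom:
  assumes "leibniz_algebra s m"
  shows "alg_hom fl_scale (*) s m (subst s m a)" and "subst s m a (gen n) = a n"
  using theI'[OF free_leibniz_universal[OF assms, of a]] by (simp_all add: subst_def)

lemma t_ideal_t_ideal_gen: "t_ideal (t_ideal_gen S)"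
proof -
  interpret F: leibniz_algebra fl_scale "(*)" by (rule leibniz_algebra_free)
  show ?thesis
    unfolding t_ideal_gen_def t_ideal_def alg_ideal_def
    by (intro conjI F.subspace_Inter) blast+
qed


section \<open>The three-dimensional algebras\<close>

definition e :: "3 \<Rightarrow> 'k::field ^ 3"
  where "e i = axis i 1"

text \<open>The bilinear product on \<open>'k ^ 3\<close> with \<open>c i j\<close> as the product of \<open>e i\<close> and \<open>e j\<close>.\<close>

definition table_mul :: "(3 \<Rightarrow> 3 \<Rightarrow> 'k::field ^ 3) \<Rightarrow> 'k ^ 3 \<Rightarrow> 'k ^ 3 \<Rightarrow> 'k ^ 3"
  where "table_mul c u v = (\<Sum>i\<in>UNIV. \<Sum>j\<in>UNIV. (u $ i * v $ j) *s c i j)"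

definition L5 :: "'k::field \<Rightarrow> 'k ^ 3 \<Rightarrow> 'k ^ 3 \<Rightarrow> 'k ^ 3"
  where "L5 \<alpha> = table_mul (\<lambda>i j.
    if i = 2 \<and> j = 2 then e 1
    else if i = 3 \<and> j = 3 then \<alpha> *s e 1
    else 0)"

definition L6 :: "'k::field \<Rightarrow> 'k ^ 3 \<Rightarrow> 'k ^ 3 \<Rightarrow> 'k ^ 3"
  where "L6 \<alpha> = table_mul (\<lambda>i j.
    if i = 2 \<and> j = 2 then e 1
    else if i = 3 \<and> j = 3 then \<alpha> *s e 1
    else if i = 2 \<and> j = 3 then e 1
    else 0)"

definition L7 :: "'k::field ^ 3 \<Rightarrow> 'k ^ 3 \<Rightarrow> 'k ^ 3"
  where "L7 = table_mul (\<lambda>i j. if i = 2 \<and> j = 3 then e 1 else 0)"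

lemma table_mul_basis: "table_mul c (e i) (e j) = c i j"
  by (simp add: table_mul_def e_def axis_def if_distrib[of "\<lambda>x. x *s _"]
      if_distrib[of "\<lambda>x. x * _"] if_distrib[of "\<lambda>x. _ * x"] sum.delta' cong: if_cong)

lemma nonassoc_algebra_table_mul: "nonassoc_algebra (*s) (table_mul c)"
  by unfold_locales
    (simp_all add: table_mul_def vec.scale_sum_right algebra_simps sum.distrib
      vec.scale_left_distrib)

lemma leibniz_L5: "leibniz_algebra (*s) (L5 \<alpha>)"
  and leibniz_L6: "leibniz_algebra (*s) (L6 \<alpha>)"
  and leibniz_L7: "leibniz_algebra (*s) L7"
  unfolding leibniz_algebra_def leibniz_algebra_axioms_def L5_def L6_def L7_def
  by (auto simp: nonassoc_algebra_table_mul)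
    (simp_all add: table_mul_def sum_3 e_def axis_def vec_eq_iff)

end

theory Submission
  imports Defs
begin

text \<open>
  Modulo the identity $x_1x_2x_3$ the Leibniz law also kills $x_1(x_2x_3)$, so every polynomial
  is congruent to $\sum_i a_i x_i + \sum_{i,j} b_{ij} x_i x_j$. Substituting
  $x_i \mapsto p$, $x_j \mapsto q$ and $0$ for all other variables into a polynomial identity of one
  of the three algebras yields $a_i = 0$ from $p = e_1$, and linear equations for $b_{ii}$,
  $b_{jj}$, $b_{ij}$, $b_{ji}$ from combinations of $e_2$ and $e_3$. For $L_6$ and $L_7$ these
  force $b = 0$; for $L_5$ they force $b$ to be alternating. Only evaluations at $0$ and
  single vectors are used, so the size of the field plays no role.
\<close>

interpretation free_leibniz:
  leibniz_algebra "fl_scale :: 'k::field \<Rightarrow> 'k free_leibniz \<Rightarrow> 'k free_leibniz" "(*)"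
  by (rule leibniz_algebra_free)

section \<open>Bilinearity of the product: zero, signs, differences, finite sums\<close>

context nonassoc_algebra
begin

lemma mul_zero_left [simp]: "mul 0 x = 0"
  using mul_add_left[of 0 0 x] by simp

lemma mul_zero_right [simp]: "mul x 0 = 0"
  using mul_add_right[of x 0 0] by simp

lemma mul_minus_left: "mul (- x) y = - mul x y"
  using mul_add_left[of "- x" x y] by (simp add: eq_neg_iff_add_eq_0)

lemma mul_minus_right: "mul x (- y) = - mul x y"
  using mul_add_right[of x "- y" y] by (simp add: eq_neg_iff_add_eq_0)

lemma mul_diff_left: "mul (x - y) z = mul x z - mul y z"
  using mul_add_left[of x "- y" z] by (simp add: mul_minus_left)

lemma mul_diff_right: "mul x (y - z) = mul x y - mul x z"
  using mul_add_right[of x y "- z"] by (simp add: mul_minus_right)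

lemma mul_sum_left: "mul (sum f A) y = (\<Sum>i\<in>A. mul (f i) y)"
  by (induction A rule: infinite_finite_induct) (simp_all add: mul_add_left)

lemma mul_sum_right: "mul x (sum f A) = (\<Sum>i\<in>A. mul x (f i))"
  by (induction A rule: infinite_finite_induct) (simp_all add: mul_add_right)

end

section \<open>Substitution and T-ideals\<close>

lemma subst_unique:
  assumes "leibniz_algebra s m" and "alg_hom fl_scale (*) s m \<phi>"
  shows "\<phi> = subst s m (\<lambda>n. \<phi> (gen n))"
  unfolding subst_def
  using the1_equality[OF free_leibniz_universal[OF assms(1), of "\<lambda>n. \<phi> (gen n)"], of \<phi>] assms(2)
  by simp

lemma alg_hom_comp:
  assumes "alg_hom s1 m1 s2 m2 f" and "alg_hom s2 m2 s3 m3 g"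
  shows "alg_hom s1 m1 s3 m3 (g \<circ> f)"
  using assms unfolding alg_hom_def by (auto intro: Vector_Spaces.linear_compose)

lemma
  assumes "leibniz_algebra s m"
  shows subst_zero: "subst s m a 0 = 0"
    and subst_add: "subst s m a (f + g) = subst s m a f + subst s m a g"
    and subst_neg: "subst s m a (- f) = - subst s m a f"
    and subst_diff: "subst s m a (f - g) = subst s m a f - subst s m a g"
    and subst_scale: "subst s m a (fl_scale c f) = s c (subst s m a f)"
    and subst_mul: "subst s m a (f * g) = m (subst s m a f) (subst s m a g)"
proof -
  note hom = subst_hom(1)[OF assms, of a]
  interpret Vector_Spaces.linear fl_scale s "subst s m a"
    using hom by (simp add: alg_hom_def)
  show "subst s m a 0 = 0" by (rule zero)
  show "subst s m a (f + g) = subst s m a f + subst s m a g" by (rule add)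
  show "subst s m a (- f) = - subst s m a f" by (rule neg)
  show "subst s m a (f - g) = subst s m a f - subst s m a g" by (rule diff)
  show "subst s m a (fl_scale c f) = s c (subst s m a f)" by (rule scale)
  show "subst s m a (f * g) = m (subst s m a f) (subst s m a g)"
    using hom by (simp add: alg_hom_def)
qed

lemmas subst_simps =
  subst_zero subst_add subst_neg subst_diff subst_scale subst_mul subst_hom(2)

text \<open>Connects the definite description \<open>subst\<close> with the recursive
  \<open>eval_lterm\<close>; since every polynomial is the class of a term, identities can be
  studied by induction on terms.\<close>

lemma subst_abs_free_leibniz:
  assumes "leibniz_algebra s m"
  shows "subst s m a (abs_free_leibniz t) = eval_lterm s m a t"
  by (induction t) (simp_all add: abs_free_leibniz_simps subst_simps[OF assms])

lemma identities_abs_free_leibniz_iff: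
  assumes "leibniz_algebra s m"
  shows "abs_free_leibniz t \<in> identities s m \<longleftrightarrow> (\<forall>a. eval_lterm s m a t = 0)"
  by (simp add: identities_def subst_abs_free_leibniz[OF assms])

lemma t_ideal_identities:
  assumes L: "leibniz_algebra s m"
  shows "t_ideal (identities s m)"
  unfolding t_ideal_def alg_ideal_def
proof (intro conjI allI ballI impI)
  interpret L: leibniz_algebra s m by (rule L)
  show "module.subspace fl_scale (identities s m)"
    by (rule free_leibniz.subspaceI) (simp_all add: identities_def subst_simps[OF L])
  show "f * g \<in> identities s m" "g * f \<in> identities s m" if "g \<in> identities s m" for f g
    using that by (simp_all add: identities_def subst_mul[OF L])
  show "\<phi> ` identities s m \<subseteq> identities s m" if \<phi>: "alg_hom fl_scale (*) fl_scale (*) \<phi>" for \<phi>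
  proof -
    have "subst s m a (\<phi> f) = 0" if f: "\<forall>a. subst s m a f = 0" for a f
    proof -
      \<comment> \<open>By uniqueness in the universal property, an endomorphism followed by a
        substitution is again a substitution, and \<open>f\<close> vanishes under all of
        these.\<close>
      have "(subst s m a \<circ> \<phi>) f = subst s m (\<lambda>n. (subst s m a \<circ> \<phi>) (gen n)) f"
        by (rule fun_cong[OF subst_unique[OF L alg_hom_comp[OF \<phi> subst_hom(1)[OF L]]]])
      also have "\<dots> = 0" using f by blast
      finally show ?thesis by simp
    qed
    then show ?thesis by (auto simp: identities_def)
  qed
qed

lemma t_ideal_subst:
  assumes "t_ideal I" and "f \<in> I"
  shows "subst fl_scale (*) a f \<in> I"
  using assms subst_hom(1)[OF leibniz_algebra_free, of a] unfolding t_ideal_def by blast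

lemma t_ideal_gen_least: "t_ideal I \<Longrightarrow> S \<subseteq> I \<Longrightarrow> t_ideal_gen S \<subseteq> I"
  unfolding t_ideal_gen_def by blast

lemma t_ideal_gen_superset: "S \<subseteq> t_ideal_gen S"
  unfolding t_ideal_gen_def by blast

lemma t_ideal_commutator:
  assumes "t_ideal I" and "gen 0 * gen 1 - gen 1 * gen 0 \<in> I"
  shows "f * g - g * f \<in> I"
  using t_ideal_subst[OF assms, of "\<lambda>n. if n = 0 then f else g"]
  by (simp add: subst_simps[OF leibniz_algebra_free])

section \<open>Normal forms modulo products of length three\<close>

text \<open>Read off a term rather than its class, so that structural recursion applies. Terms have
  no constant part, hence a product contributes nothing in degree one, and in degree two only the
  product of the linear parts of its factors.\<close>

primrec lin_coeff :: "'k::field lterm \<Rightarrow> nat \<Rightarrow> 'k" where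
  "lin_coeff (Var n) i = of_bool (i = n)"
| "lin_coeff Zero i = 0"
| "lin_coeff (Add t u) i = lin_coeff t i + lin_coeff u i"
| "lin_coeff (Neg t) i = - lin_coeff t i"
| "lin_coeff (Scale c t) i = c * lin_coeff t i"
| "lin_coeff (Mul t u) i = 0"

primrec quad_coeff :: "'k::field lterm \<Rightarrow> nat \<Rightarrow> nat \<Rightarrow> 'k" where
  "quad_coeff (Var n) i j = 0"
| "quad_coeff Zero i j = 0"
| "quad_coeff (Add t u) i j = quad_coeff t i j + quad_coeff u i j"
| "quad_coeff (Neg t) i j = - quad_coeff t i j"
| "quad_coeff (Scale c t) i j = c * quad_coeff t i j"
| "quad_coeff (Mul t u) i j = lin_coeff t i * lin_coeff u j"

text \<open>The cut-off \<open>N\<close> keeps the sum finite; the whole linear part is captured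
  once \<open>N\<close> exceeds every variable index in \<open>t\<close>.\<close>

definition lin_part :: "nat \<Rightarrow> 'k::field lterm \<Rightarrow> 'k free_leibniz" where
  "lin_part N t = (\<Sum>i<N. fl_scale (lin_coeff t i) (gen i))"

definition quad_part :: "nat \<Rightarrow> 'k::field lterm \<Rightarrow> 'k free_leibniz" where
  "quad_part N t = (\<Sum>i<N. \<Sum>j<N. fl_scale (quad_coeff t i j) (gen i * gen j))"

lemma lin_part_simps:
  "n < N \<Longrightarrow> lin_part N (Var n) = gen n"
  "lin_part N Zero = 0"
  "lin_part N (Add t u) = lin_part N t + lin_part N u"
  "lin_part N (Neg t) = - lin_part N t"
  "lin_part N (Scale c t) = fl_scale c (lin_part N t)"
  "lin_part N (Mul t u) = 0"
  by (simp_all add: lin_part_def free_leibniz.scale_left_distrib sum.distrib sum_negf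
      free_leibniz.scale_sum_right of_bool_def if_distrib[of "\<lambda>c. fl_scale c _"] cong: if_cong)

lemma quad_part_simps:
  "quad_part N (Var n) = 0"
  "quad_part N Zero = 0"
  "quad_part N (Add t u) = quad_part N t + quad_part N u"
  "quad_part N (Neg t) = - quad_part N t"
  "quad_part N (Scale c t) = fl_scale c (quad_part N t)"
  "quad_part N (Mul t u) = lin_part N t * lin_part N u"
proof -
  show "quad_part N (Mul t u) = lin_part N t * lin_part N u"
    unfolding quad_part_def lin_part_def free_leibniz.mul_sum_left
    by (simp add: free_leibniz.mul_sum_right free_leibniz.mul_scale_left
        free_leibniz.mul_scale_right mult.commute)
qed (simp_all add: quad_part_def free_leibniz.scale_left_distrib sum.distrib sum_negf
      free_leibniz.scale_sum_right)

section \<open>T-ideals containing the left-normed product of three variables\<close>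

locale nilpotent_t_ideal =
  fixes I :: "'k::field free_leibniz set"
  assumes t_ideal: "t_ideal I" and triple: "gen 0 * gen 1 * gen 2 \<in> I"
begin

lemma subspace: "module.subspace fl_scale I"
  and ideal: "f \<in> I \<Longrightarrow> g * f \<in> I" "f \<in> I \<Longrightarrow> f * g \<in> I"
  using t_ideal unfolding t_ideal_def alg_ideal_def by blast+

lemma mul_left_nested: "f * g * h \<in> I"
  \<comment> \<open>Only the first three variables occur in the generator, so the value
    \<open>h\<close> at all later ones is an arbitrary default.\<close>
  using t_ideal_subst[OF t_ideal triple, of "\<lambda>n. if n = 0 then f else if n = 1 then g else h"]
  by (simp add: subst_simps[OF leibniz_algebra_free])

text \<open>The Leibniz law turns the product into a difference of two left-normed triple
  products.\<close>

lemma mul_right_nested: "f * (g * h) \<in> I"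
  unfolding free_leibniz.leibniz
  by (intro free_leibniz.subspace_diff[OF subspace] mul_left_nested)

lemma quad_part_mul: "quad_part N t * f \<in> I"
  unfolding quad_part_def free_leibniz.mul_sum_left free_leibniz.mul_scale_left
  by (intro free_leibniz.subspace_sum[OF subspace] free_leibniz.subspace_scale[OF subspace]
      mul_left_nested)

lemma mul_quad_part: "f * quad_part N t \<in> I"
  unfolding quad_part_def free_leibniz.mul_sum_right free_leibniz.mul_scale_right
  by (intro free_leibniz.subspace_sum[OF subspace] free_leibniz.subspace_scale[OF subspace]
      mul_right_nested)

lemma normal_form:
  "\<exists>N. \<forall>M\<ge>N. abs_free_leibniz t - (lin_part M t + quad_part M t) \<in> I"
proof -
  let ?r = "\<lambda>M t. abs_free_leibniz t - (lin_part M t + quad_part M t)"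
  \<comment> \<open>Phrased with "eventually", the binary cases of the induction combine the
    thresholds of both subterms automatically.\<close>
  have "\<forall>\<^sub>F M in sequentially. ?r M t \<in> I"
  proof (induction t)
    case (Var n)
    show ?case
      using eventually_gt_at_top[of n]
      by eventually_elim
        (simp add: abs_free_leibniz_simps lin_part_simps quad_part_simps
          free_leibniz.subspace_0[OF subspace])
  next
    case Zero
    show ?case
      by (simp add: abs_free_leibniz_simps lin_part_simps quad_part_simps
          free_leibniz.subspace_0[OF subspace])
  next
    case (Add t u)
    then show ?case
    proof eventually_elim
      case (elim M)
      have "?r M (Add t u) = ?r M t + ?r M u"
        by (simp add: abs_free_leibniz_simps lin_part_simps quad_part_simps)
      with elim show ?case by (simp only: free_leibniz.subspace_add[OF subspace])
    qed
  next
    case (Neg t)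
    then show ?case
    proof eventually_elim
      case (elim M)
      have "?r M (Neg t) = - ?r M t"
        by (simp add: abs_free_leibniz_simps lin_part_simps quad_part_simps)
      with elim show ?case by (simp only: free_leibniz.subspace_neg[OF subspace])
    qed
  next
    case (Scale c t)
    then show ?case
    proof eventually_elim
      case (elim M)
      have "?r M (Scale c t) = fl_scale c (?r M t)"
        by (simp add: abs_free_leibniz_simps lin_part_simps quad_part_simps
            free_leibniz.scale_right_distrib free_leibniz.scale_right_diff_distrib)
      with elim show ?case by (simp only: free_leibniz.subspace_scale[OF subspace])
    qed
  next
    case (Mul t u)
    then show ?case
    proof eventually_elim
      case (elim M)
      \<comment> \<open>The quadratic part of a product is the product of the linear parts.
        Replacing first \<open>t\<close> and then \<open>u\<close> by its linear part leaves errors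
        that contain a remainder in \<open>I\<close> or a product of three factors.\<close>
      have "?r M (Mul t u) = (?r M t * abs_free_leibniz u + quad_part M t * abs_free_leibniz u)
          + (lin_part M t * ?r M u + lin_part M t * quad_part M u)"
        by (simp add: abs_free_leibniz_simps lin_part_simps quad_part_simps
            free_leibniz.mul_add_left free_leibniz.mul_add_right
            free_leibniz.mul_diff_left free_leibniz.mul_diff_right)
      also have "\<dots> \<in> I"
        using elim
        by (intro free_leibniz.subspace_add[OF subspace] ideal quad_part_mul mul_quad_part)
      finally show ?case .
    qed
  qed
  then show ?thesis by (simp add: eventually_sequentially)
qed

text \<open>Pairing $F_{ij}$ with $F_{ji}$ instead of halving keeps characteristic 2 included.\<close>

lemma sum_symmetrized_mem:
  fixes N :: nat
  assumes "\<And>i. F i i \<in> I" and "\<And>i j. F i j + F j i \<in> I"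
  shows "(\<Sum>i<N. \<Sum>j<N. F i j) \<in> I"
proof (induction N)
  case 0
  show ?case by (simp add: free_leibniz.subspace_0[OF subspace])
next
  case (Suc N)
  \<comment> \<open>Enlarging the square adds a row and a column, paired entry by entry, and a
    corner on the diagonal.\<close>
  have "(\<Sum>i<Suc N. \<Sum>j<Suc N. F i j) =
      (\<Sum>i<N. \<Sum>j<N. F i j) + ((\<Sum>i<N. F i N + F N i) + F N N)"
    by (simp add: sum.distrib add_ac)
  also have "\<dots> \<in> I"
    using Suc assms
    by (simp only: free_leibniz.subspace_add[OF subspace] free_leibniz.subspace_sum[OF subspace])
  finally show ?case .
qed

text \<open>The second assumption ranges over all \<open>N\<close> because the threshold supplied by
  \<open>normal_form\<close> depends on \<open>t\<close>.\<close>

lemma mem_if_quad_part_mem: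
  assumes "\<And>i. lin_coeff t i = 0" and "\<And>N. quad_part N t \<in> I"
  shows "abs_free_leibniz t \<in> I"
proof -
  obtain N where N: "abs_free_leibniz t - (lin_part N t + quad_part N t) \<in> I"
    using normal_form by blast
  have "lin_part N t = 0" by (simp add: lin_part_def assms(1))
  with free_leibniz.subspace_add[OF subspace N assms(2)[of N]] show ?thesis by simp
qed

end

section \<open>Leibniz algebras with vanishing triple products\<close>

locale nilpotent_leibniz_algebra = leibniz_algebra scale mul
  for scale :: "'k::field \<Rightarrow> 'v::ab_group_add \<Rightarrow> 'v" and mul :: "'v \<Rightarrow> 'v \<Rightarrow> 'v" +
  assumes triple: "mul (mul x y) z = 0"
begin

lemma triple_right: "mul x (mul y z) = 0"
  by (simp add: leibniz triple)

lemma triple_mem_identities: "gen 0 * gen 1 * gen 2 \<in> identities scale mul"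
  by (simp add: identities_def subst_mul[OF leibniz_algebra_axioms] triple)

lemma commutator_mem_identities:
  assumes "\<And>x y. mul x y = mul y x"
  shows "gen 0 * gen 1 - gen 1 * gen 0 \<in> identities scale mul"
  using assms by (simp add: identities_def subst_simps[OF leibniz_algebra_axioms])

text \<open>Products of three factors evaluate to 0, so only degrees one and two survive. A
  quadratic monomial involves at most two variables, so two nonzero values suffice to reach every
  coefficient.\<close>

lemma eval_two_variables:
  assumes "i \<noteq> j"
  shows "eval_lterm scale mul (\<lambda>n. if n = i then p else if n = j then q else 0) t =
    scale (lin_coeff t i) p + scale (lin_coeff t j) q +
    (scale (quad_coeff t i i) (mul p p) + scale (quad_coeff t i j) (mul p q) +
     scale (quad_coeff t j i) (mul q p) + scale (quad_coeff t j j) (mul q q))"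
  using assms
  by (induction t)
    (simp_all add: mul_add_left mul_add_right mul_scale_left mul_scale_right triple triple_right
      scale_left_distrib scale_right_distrib add_ac mult.commute)

lemma identity_two_variables:
  assumes "abs_free_leibniz t \<in> identities scale mul" and "i \<noteq> j"
  shows "scale (lin_coeff t i) p + scale (lin_coeff t j) q +
    (scale (quad_coeff t i i) (mul p p) + scale (quad_coeff t i j) (mul p q) +
     scale (quad_coeff t j i) (mul q p) + scale (quad_coeff t j j) (mul q q)) = 0"
  using assms(1)
  unfolding eval_two_variables[OF assms(2), symmetric]
    identities_abs_free_leibniz_iff[OF leibniz_algebra_axioms]
  by (rule spec)

lemma identity_one_variable:
  assumes "abs_free_leibniz t \<in> identities scale mul"
  shows "scale (lin_coeff t i) p + scale (quad_coeff t i i) (mul p p) = 0"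
  \<comment> \<open>\<open>Suc i\<close> serves as some index different from \<open>i\<close>; its
    variable receives 0.\<close>
  using identity_two_variables[OF assms, of i "Suc i" p 0] by simp

lemma identity_lin_coeff:
  assumes "abs_free_leibniz t \<in> identities scale mul" and "mul p p = 0" and "p \<noteq> 0"
  shows "lin_coeff t i = 0"
  using identity_one_variable[OF assms(1), of i p] assms(2,3) by simp

lemma identity_quad_coeff_diag:
  assumes "abs_free_leibniz t \<in> identities scale mul" and "lin_coeff t i = 0" and "mul p p \<noteq> 0"
  shows "quad_coeff t i i = 0"
  using identity_one_variable[OF assms(1), of i p] assms(2,3) by simp

end

text \<open>Provides what minimality of a generated T-ideal requires for its inclusion in the
  identities.\<close>

sublocale nilpotent_leibniz_algebra \<subseteq> identities: nilpotent_t_ideal "identities scale mul"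
  by unfold_locales (rule t_ideal_identities[OF leibniz_algebra_axioms] triple_mem_identities)+

section \<open>The three-dimensional algebras\<close>

lemma e_nth: "e i $ j = of_bool (j = i)"
  by (simp add: e_def axis_def)

lemma e_neq_0: "e i \<noteq> 0"
  by (simp add: e_def)

text \<open>In all three algebras the product is a bilinear form in coordinates 2 and 3, times
  \<open>e 1\<close>. Hence \<open>e 1\<close> annihilates everything from both sides and triple
  products vanish.\<close>

lemma L5_eq: "L5 \<alpha> u v = (u $ 2 * v $ 2 + \<alpha> * (u $ 3 * v $ 3)) *s e 1"
  by (simp add: L5_def table_mul_def sum_3 e_nth vec_eq_iff algebra_simps)

lemma L6_eq: "L6 \<alpha> u v = (u $ 2 * v $ 2 + \<alpha> * (u $ 3 * v $ 3) + u $ 2 * v $ 3) *s e 1"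
  by (simp add: L6_def table_mul_def sum_3 e_nth vec_eq_iff algebra_simps)

lemma L7_eq: "L7 u v = (u $ 2 * v $ 3) *s e 1"
  by (simp add: L7_def table_mul_def sum_3 e_nth vec_eq_iff)

interpretation L5: nilpotent_leibniz_algebra "(*s)" "L5 \<alpha>" for \<alpha> :: "'k::field"
  by (intro nilpotent_leibniz_algebra.intro leibniz_L5 nilpotent_leibniz_algebra_axioms.intro)
    (simp add: L5_eq e_nth)

interpretation L6: nilpotent_leibniz_algebra "(*s)" "L6 \<alpha>" for \<alpha> :: "'k::field"
  by (intro nilpotent_leibniz_algebra.intro leibniz_L6 nilpotent_leibniz_algebra_axioms.intro)
    (simp add: L6_eq e_nth)

interpretation L7: nilpotent_leibniz_algebra "(*s)" "L7 :: 'k::field ^ 3 \<Rightarrow> _"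
  by (intro nilpotent_leibniz_algebra.intro leibniz_L7 nilpotent_leibniz_algebra_axioms.intro)
    (simp add: L7_eq e_nth)

section \<open>Linear equations for the coefficients of an identity\<close>

lemma identities_L5_coeff:
  assumes "abs_free_leibniz t \<in> identities (*s) (L5 \<alpha>)"
  shows "lin_coeff t i = 0" and "quad_coeff t i i = 0"
    and "quad_coeff t i j + quad_coeff t j i = 0"
proof -
  show lin: "lin_coeff t i = 0" for i
    by (rule L5.identity_lin_coeff[OF assms, where p = "e 1"]) (simp_all add: L5_eq e_nth e_neq_0)
  show diag: "quad_coeff t i i = 0" for i
    by (rule L5.identity_quad_coeff_diag[OF assms lin, where p = "e 2"])
      (simp add: L5_eq e_nth e_neq_0)
  show "quad_coeff t i j + quad_coeff t j i = 0"
  proof (cases "i = j")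
    case False
    \<comment> \<open>With \<open>e 2\<close> for both variables all four products equal
      \<open>e 1\<close>; since the diagonal coefficients are 0, the sum of the two mixed ones
      remains.\<close>
    from L5.identity_two_variables[OF assms this, of "e 2" "e 2"] show ?thesis
      by (simp add: lin diag L5_eq e_nth e_neq_0 flip: vec.scale_left_distrib)
  qed (simp add: diag)
qed

lemma identities_L6_coeff:
  assumes "abs_free_leibniz t \<in> identities (*s) (L6 \<alpha>)"
  shows "lin_coeff t i = 0" and "quad_coeff t i j = 0"
proof -
  show lin: "lin_coeff t i = 0" for i
    by (rule L6.identity_lin_coeff[OF assms, where p = "e 1"]) (simp_all add: L6_eq e_nth e_neq_0)
  have diag: "quad_coeff t i i = 0" for i
    by (rule L6.identity_quad_coeff_diag[OF assms lin, where p = "e 2"])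
      (simp add: L6_eq e_nth e_neq_0)
  show "quad_coeff t i j = 0"
  proof (cases "i = j")
    case False
    \<comment> \<open>Here \<open>e 2\<close> times \<open>e 3\<close> is \<open>e 1\<close> but
      \<open>e 3\<close> times \<open>e 2\<close> is 0, which isolates one mixed
      coefficient.\<close>
    from L6.identity_two_variables[OF assms this, of "e 2" "e 3"] show ?thesis
      by (simp add: lin diag L6_eq e_nth e_neq_0)
  qed (simp add: diag)
qed

lemma identities_L7_coeff:
  assumes "abs_free_leibniz t \<in> identities (*s) (L7 :: 'k::field ^ 3 \<Rightarrow> _)"
  shows "lin_coeff t i = 0" and "quad_coeff t i j = 0"
proof -
  show lin: "lin_coeff t i = 0" for i
    by (rule L7.identity_lin_coeff[OF assms, where p = "e 1"]) (simp_all add: L7_eq e_nth e_neq_0)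
  \<comment> \<open>Every basis vector of \<open>L7\<close> has square 0, whereas
    \<open>e 2 + e 3\<close> has square \<open>e 1\<close>.\<close>
  have diag: "quad_coeff t i i = 0" for i
    by (rule L7.identity_quad_coeff_diag[OF assms lin, where p = "e 2 + e 3"])
      (simp add: L7_eq e_nth e_neq_0)
  show "quad_coeff t i j = 0"
  proof (cases "i = j")
    case False
    from L7.identity_two_variables[OF assms this, of "e 2" "e 3"] show ?thesis
      by (simp add: lin diag L7_eq e_nth e_neq_0)
  qed (simp add: diag)
qed

section \<open>Identities as generated T-ideals\<close>

lemma (in nilpotent_leibniz_algebra) identities_eq_t_ideal_gen_triple:
  assumes "\<And>t i. abs_free_leibniz t \<in> identities scale mul \<Longrightarrow> lin_coeff t i = 0"
    and "\<And>t i j. abs_free_leibniz t \<in> identities scale mul \<Longrightarrow> quad_coeff t i j = 0"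
  shows "identities scale mul = t_ideal_gen {gen 0 * gen 1 * gen 2}"
proof
  interpret T: nilpotent_t_ideal "t_ideal_gen {gen 0 * gen 1 * gen 2} :: 'k free_leibniz set"
    by unfold_locales (rule t_ideal_t_ideal_gen, rule subsetD[OF t_ideal_gen_superset], simp)
  show "identities scale mul \<subseteq> t_ideal_gen {gen 0 * gen 1 * gen 2}"
  proof
    fix f assume "f \<in> identities scale mul"
    then show "f \<in> t_ideal_gen {gen 0 * gen 1 * gen 2}"
    proof (induction f)
      case (1 t)
      \<comment> \<open>All coefficients vanish, so the quadratic part is 0 for every
        cut-off.\<close>
      show ?case
        by (rule T.mem_if_quad_part_mem)
          (simp_all add: quad_part_def assms[OF 1] free_leibniz.subspace_0[OF T.subspace]
            del: One_nat_def)
    qed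
  qed
  show "t_ideal_gen {gen 0 * gen 1 * gen 2} \<subseteq> identities scale mul"
    by (intro t_ideal_gen_least identities.t_ideal) (simp add: identities.triple del: One_nat_def)
qed

text \<open>The quadratic coefficients of an identity form an alternating matrix, so its quadratic
  part is a combination of commutators of generators. Conversely, the product of \<open>L5\<close>
  is commutative and its triple products vanish.\<close>

lemma identities_L5_eq:
  "identities (*s) (L5 \<alpha>) = t_ideal_gen {gen 0 * gen 1 - gen 1 * gen 0, gen 0 * gen 1 * gen 2}"
  (is "_ = t_ideal_gen ?S")
proof
  interpret T: nilpotent_t_ideal "t_ideal_gen ?S"
    by unfold_locales (rule t_ideal_t_ideal_gen, rule subsetD[OF t_ideal_gen_superset], simp)
  have comm: "f * g - g * f \<in> t_ideal_gen ?S" for f g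
    by (rule t_ideal_commutator[OF T.t_ideal], rule subsetD[OF t_ideal_gen_superset], simp)
  show "identities (*s) (L5 \<alpha>) \<subseteq> t_ideal_gen ?S"
  proof
    fix f assume "f \<in> identities (*s) (L5 \<alpha>)"
    then show "f \<in> t_ideal_gen ?S"
    proof (induction f)
      case (1 t)
      note coeff = identities_L5_coeff[OF 1]
      show ?case
      proof (rule T.mem_if_quad_part_mem[OF coeff(1)], unfold quad_part_def,
          rule T.sum_symmetrized_mem)
        fix i j
        show "fl_scale (quad_coeff t i i) (gen i * gen i) \<in> t_ideal_gen ?S"
          by (simp add: coeff(2) free_leibniz.subspace_0[OF T.subspace] del: One_nat_def)
        have "quad_coeff t j i = - quad_coeff t i j"
          using coeff(3)[of i j] by (simp add: eq_neg_iff_add_eq_0 add.commute)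
        then have "fl_scale (quad_coeff t i j) (gen i * gen j)
              + fl_scale (quad_coeff t j i) (gen j * gen i)
            = fl_scale (quad_coeff t i j) (gen i * gen j - gen j * gen i)"
          by (simp add: free_leibniz.scale_right_diff_distrib)
        then show "fl_scale (quad_coeff t i j) (gen i * gen j)
              + fl_scale (quad_coeff t j i) (gen j * gen i) \<in> t_ideal_gen ?S"
          by (simp only: free_leibniz.subspace_scale[OF T.subspace] comm)
      qed
    qed
  qed
  have "L5 \<alpha> x y = L5 \<alpha> y x" for x y
    by (simp add: L5_eq mult.commute)
  then show "t_ideal_gen ?S \<subseteq> identities (*s) (L5 \<alpha>)"
    by (intro t_ideal_gen_least L5.identities.t_ideal)
      (simp add: L5.commutator_mem_identities L5.identities.triple del: One_nat_def)
qed

theorem theorem3p1: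
  fixes \<alpha> :: "'k::field"
  assumes "\<alpha> \<noteq> 0"
  shows "identities (*s) (L6 \<alpha>) = identities (*s) (L7 :: 'k ^ 3 \<Rightarrow> 'k ^ 3 \<Rightarrow> 'k ^ 3)
    \<and> identities (*s) (L7 :: 'k ^ 3 \<Rightarrow> 'k ^ 3 \<Rightarrow> 'k ^ 3) = t_ideal_gen {gen 0 * gen 1 * gen 2}
    \<and> identities (*s) (L5 \<alpha>) =
        t_ideal_gen {gen 0 * gen 1 - gen 1 * gen 0, gen 0 * gen 1 * gen 2}"
proof (intro conjI)
  have L6: "identities (*s) (L6 \<alpha>) = t_ideal_gen {gen 0 * gen 1 * gen 2}"
    by (intro L6.identities_eq_t_ideal_gen_triple identities_L6_coeff)
  show L7: "identities (*s) (L7 :: 'k ^ 3 \<Rightarrow> 'k ^ 3 \<Rightarrow> 'k ^ 3) = t_ideal_gen {gen 0 * gen 1 * gen 2}"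
    by (intro L7.identities_eq_t_ideal_gen_triple identities_L7_coeff)
  show "identities (*s) (L6 \<alpha>) = identities (*s) (L7 :: 'k ^ 3 \<Rightarrow> 'k ^ 3 \<Rightarrow> 'k ^ 3)"
    by (simp only: L6 L7)
qed (rule identities_L5_eq)

end
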